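(* Call a set $\{x_1,\dots,x_9\}$ of nine pairwise distinct positive integers admissible if $\frac{1}{x_1}+\dots+\frac{1}{x_9}=1$ and there is an odd prime $q$ such that every $x_i$ is of the form $2^{a_i}q^{b_i}$ with $a_i\in\{0,1,2\}$ and $b_i\geq 0$ an integer. There are exactly $54$ admissible sets.
   Context: Solutions are counted as unordered sets of distinct integers. The same odd prime $q$ is used for all nine entries of a given set, and the exponent of $2$ in each entry is at most $2$. *)

theory Defs
  imports Complex_Main "HOL-Computational_Algebra.Primes"
begin

definition admissible :: "nat set \<Rightarrow> bool" where
  "admissible X \<longleftrightarrow>
     card X = 9 \<and>
     (\<forall>x\<in>X. x > 0) \<and>
     (\<Sum>x\<in>X. 1 / real x) = 1 \<and>
     (\<exists>q::nat. prime q \<and> odd q \<and>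
        (\<forall>x\<in>X. \<exists>a b :: nat. a \<in> {0, 1, 2} \<and> x = 2 ^ a * q ^ b))"

end

theory Submission
  imports Defs
begin

text \<open>
  After multiplication by 4, the entries with a fixed exponent \<open>b\<close> of \<open>q\<close> contribute
  \<open>c / q ^ b\<close>, where \<open>c \<in> {0..7}\<close> is the sum of a subset of \<open>{4, 2, 1}\<close>. So a solution is a
  digit sequence with \<open>c\<^sub>0 + c\<^sub>1 / q + c\<^sub>2 / q\<^sup>2 + \<dots> = 4\<close> and nine binary ones in total.
  Stripping off the leading digit sends the remainder \<open>r\<close> to \<open>q * (r - c)\<close>. As all remainders
  are nonnegative and less than \<open>7 * q / (q - 1)\<close>, none works for \<open>q \<ge> 9\<close>, and for
  \<open>q = 3, 5, 7\<close> the recursion has at most three positive states besides the initial one; it yields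
  \<open>52 + 1 + 1\<close> solutions.
\<close>

section \<open>Encoding of solutions by digits in base \<open>q\<close>\<close>

definition smooth :: "nat \<Rightarrow> nat set" where
  "smooth q = {2 ^ a * q ^ b | a b. a \<le> 2}"

definition unit_sum :: "nat set \<Rightarrow> real" where
  "unit_sum Y = (\<Sum>y\<in>Y. 4 / real y)"

definition sols :: "nat \<Rightarrow> int \<Rightarrow> nat \<Rightarrow> nat set set" where
  "sols q r k = {Y. finite Y \<and> Y \<subseteq> smooth q \<and> card Y = k \<and> unit_sum Y = of_int r}"

text \<open>The digit belonging to \<open>C\<close>. The integer division is exact in all uses,
  where \<open>C\<close> is a subset of \<open>{1, 2, 4}\<close>.\<close>

definition weight :: "nat set \<Rightarrow> int" where
  "weight C = (\<Sum>x\<in>C. 4 div int x)"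

text \<open>Undoes the removal of the leading digit: \<open>C\<close> holds the entries with
  exponent 0 of \<open>q\<close>, and \<open>Y\<close> holds the remaining ones divided by
  \<open>q\<close>.\<close>

definition join :: "nat \<Rightarrow> nat set \<Rightarrow> nat set \<Rightarrow> nat set" where
  "join q C Y = C \<union> (*) q ` Y"

lemma smooth_unfold: "smooth q = {1, 2, 4} \<union> (*) q ` smooth q"
proof (intro equalityI subsetI)
  fix x assume "x \<in> smooth q"
  then obtain a b where x: "x = 2 ^ a * q ^ b" "a \<le> 2"
    by (auto simp: smooth_def)
  show "x \<in> {1, 2, 4} \<union> (*) q ` smooth q"
  proof (cases b)
    case 0
    have "a = 0 \<or> a = 1 \<or> a = 2" using x(2) by auto
    then show ?thesis using x 0 by auto
  next
    case (Suc b')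
    then have "x = q * (2 ^ a * q ^ b')" using x by simp
    then show ?thesis using x(2) by (auto simp: smooth_def)
  qed
next
  have mem: "2 ^ a * q ^ b \<in> smooth q" if "a \<le> 2" for a b
    using that by (auto simp: smooth_def)
  have "q * y \<in> smooth q" if "y \<in> smooth q" for y
    using that mem[of _ "Suc _"] by (auto simp: smooth_def mult.left_commute)
  moreover have "{1, 2, 4} \<subseteq> smooth q"
    using mem[of 0 0] mem[of 1 0] mem[of 2 0] by simp
  ultimately show "x \<in> smooth q" if "x \<in> {1, 2, 4} \<union> (*) q ` smooth q" for x
    using that by blast
qed

lemma smooth_pos: "y > 0" if "y \<in> smooth q" "q > 0"
  using that by (auto simp: smooth_def)

text \<open>Serves to unroll the sum over the eight subsets of \<open>{1, 2, 4}\<close>, that is,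
  over the possible digits.\<close>

lemma sum_Pow_insert:
  assumes "finite A" "x \<notin> A"
  shows "sum f (Pow (insert x A)) = sum f (Pow A) + (\<Sum>B\<in>Pow A. f (insert x B))"
proof -
  have "Pow A \<inter> insert x ` Pow A = {}" "inj_on (insert x) (Pow A)"
    using assms(2) by (auto simp: inj_on_def)
  then show ?thesis
    using assms(1) by (simp add: Pow_insert sum.union_disjoint sum.reindex)
qed

section \<open>Splitting off the leading digit\<close>

locale odd_base =
  fixes q :: nat
  assumes q_odd: "odd q" and q_ge: "q \<ge> 3"
begin

lemma mult_notin: "q * y \<notin> {1, 2, 4}"
proof
  assume "q * y \<in> {1, 2, 4}"
  then have "q * y dvd 2 ^ 2" by auto
  then have "q dvd 2 ^ 2" by (rule dvd_mult_left)
  moreover have "coprime q (2 ^ 2)"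
    using q_odd by (simp only: coprime_power_right_iff coprime_right_2_iff_odd simp_thms)
  ultimately have "q = 1" by (metis coprime_absorb_left nat_dvd_1_iff_1)
  then show False using q_ge by simp
qed

lemma inj_mult: "inj_on ((*) q) A"
  using q_ge by (auto simp: inj_on_def)

lemma image_mult_Int: "(*) q ` Z \<inter> {1, 2, 4} = {}"
  using mult_notin by fast

text \<open>No multiple of \<open>q\<close> lies in \<open>{1, 2, 4}\<close>, so intersecting with
  this set recovers \<open>C\<close>, and what is left over is the image of
  \<open>Y\<close>.\<close>

lemma join_inject:
  assumes "C \<subseteq> {1, 2, 4}" "C' \<subseteq> {1, 2, 4}" "join q C Y = join q C' Y'"
  shows "C = C' \<and> Y = Y'"
proof -
  have split: "join q D Z \<inter> {1, 2, 4} = D" "join q D Z - {1, 2, 4} = (*) q ` Z"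
    if "D \<subseteq> {1, 2, 4}" for D Z
    using that image_mult_Int[of Z] unfolding join_def by blast+
  have "C = C'"
    using split(1)[OF assms(1), of Y] split(1)[OF assms(2), of Y'] assms(3) by simp
  moreover have "(*) q ` Y = (*) q ` Y'"
    using split(2)[OF assms(1), of Y] split(2)[OF assms(2), of Y'] assms(3) by simp
  ultimately show ?thesis using inj_mult[of UNIV] by (simp add: inj_image_eq_iff)
qed

lemma join_surj:
  assumes "finite Y" "Y \<subseteq> smooth q"
  obtains C Z where "C \<subseteq> {1, 2, 4}" "finite Z" "Z \<subseteq> smooth q" "Y = join q C Z"
proof
  define Z where "Z = {z \<in> smooth q. q * z \<in> Y}"
  show "Y \<inter> {1, 2, 4} \<subseteq> {1, 2, 4}" "Z \<subseteq> smooth q" by (auto simp: Z_def)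
  have "(*) q ` Z \<subseteq> Y" by (auto simp: Z_def)
  then show "finite Z"
    using assms(1) inj_mult finite_imageD finite_subset by blast
  show "Y = join q (Y \<inter> {1, 2, 4}) Z"
    using assms(2) smooth_unfold[of q] unfolding join_def Z_def by blast
qed

lemma join_facts:
  assumes "C \<subseteq> {1, 2, 4}" "finite Z" "Z \<subseteq> smooth q"
  shows finite_join: "finite (join q C Z)"
    and join_smooth: "join q C Z \<subseteq> smooth q"
    and card_join: "card (join q C Z) = card C + card Z"
    and unit_sum_join: "unit_sum (join q C Z) = of_int (weight C) + unit_sum Z / real q"
    and sum_join: "\<Sum> (join q C Z) = \<Sum> C + q * \<Sum> Z"
proof -
  have fC: "finite C" using assms(1) finite_subset by blast
  have disj: "C \<inter> (*) q ` Z = {}" using assms(1) image_mult_Int[of Z] by blast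
  show "finite (join q C Z)" using fC assms(2) by (simp add: join_def)
  show "join q C Z \<subseteq> smooth q"
    using assms smooth_unfold[of q] unfolding join_def by blast
  show "card (join q C Z) = card C + card Z"
    using fC assms(2) disj by (simp add: join_def card_Un_disjoint card_image inj_mult)
  have "4 / real x = of_int (4 div int x)" if "x \<in> C" for x
    using that assms(1) by auto
  then have "(\<Sum>x\<in>C. 4 / real x) = of_int (weight C)" by (simp add: weight_def)
  then show "unit_sum (join q C Z) = of_int (weight C) + unit_sum Z / real q"
    using fC assms(2) disj
    by (simp add: join_def unit_sum_def sum.union_disjoint sum.reindex inj_mult
        sum_divide_distrib) (simp add: mult.commute)
  show "\<Sum> (join q C Z) = \<Sum> C + q * \<Sum> Z"
    using fC assms(2) disj
    by (simp add: join_def sum.union_disjoint sum.reindex inj_mult sum_distrib_left)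
qed

section \<open>Bounds on the remainders\<close>

lemma weight_le: "weight C \<le> 7" if "C \<subseteq> {1, 2, 4}"
proof -
  have "weight C \<le> weight {1, 2, 4}"
    unfolding weight_def using that by (intro sum_mono2) auto
  then show ?thesis by (simp add: weight_def)
qed

text \<open>Digits are at most 7, so this is the bound by the geometric series
  \<open>7 * (1 + 1 / q + ...)\<close>. It is strict because only finitely many digits are nonzero.
  The series is replaced by induction along \<open>join\<close>, with the sum of the entries as
  measure.\<close>

lemma unit_sum_less:
  assumes "finite Y" "Y \<subseteq> smooth q"
  shows "(real q - 1) * unit_sum Y < 7 * real q"
  using assms
proof (induction "\<Sum> Y" arbitrary: Y rule: less_induct)
  case less
  show ?case
  proof (cases "Y = {}")
    case True
    then show ?thesis using q_ge by (simp add: unit_sum_def)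
  next
    case False
    obtain C Z where CZ: "C \<subseteq> {1, 2, 4}" "finite Z" "Z \<subseteq> smooth q" "Y = join q C Z"
      using join_surj[OF less.prems] .
    have "\<Sum> Z < \<Sum> Y"
    \<comment> \<open>Multiplying by \<open>q\<close> increases only a nonzero sum; if the sum over
      \<open>Z\<close> is 0, the decrease comes from a positive entry of \<open>Y\<close>.\<close>
    proof (cases "\<Sum> Z = 0")
      case True
      obtain y where "y \<in> Y" using False by blast
      moreover have "y > 0" using \<open>y \<in> Y\<close> less.prems smooth_pos[of y q] q_ge by auto
      ultimately have "\<Sum> Y \<noteq> 0" using less.prems(1) by auto
      then show ?thesis using True by simp
    next
      case False
      then have "\<Sum> Z < q * \<Sum> Z" using q_ge by simp
      then show ?thesis unfolding CZ(4) sum_join[OF CZ(1-3)] by linarith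
    qed
    then have Z: "(real q - 1) * unit_sum Z < 7 * real q"
      using less.hyps CZ by blast
    have "(real q - 1) * unit_sum Y
        = (real q - 1) * of_int (weight C) + (real q - 1) * unit_sum Z / real q"
      using unit_sum_join[OF CZ(1-3)] CZ(4) by (simp add: distrib_left)
    also have "(real q - 1) * unit_sum Z / real q < 7"
      using Z q_ge by (simp add: divide_less_eq)
    also have "(real q - 1) * of_int (weight C) \<le> (real q - 1) * 7"
      using weight_le[OF CZ(1)] q_ge by (intro mult_left_mono) auto
    finally show ?thesis by (simp add: algebra_simps)
  qed
qed

lemma sols_large: "sols q r k = {}" if "(int q - 1) * r \<ge> 7 * int q"
proof -
  have "(real q - 1) * of_int r \<ge> 7 * real q"
    using of_int_le_iff[where 'a = real, THEN iffD2, OF that] by simp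
  then show ?thesis using unit_sum_less by (force simp: sols_def)
qed

lemma unit_sum_pos: "unit_sum Y > 0" if "finite Y" "Y \<subseteq> smooth q" "Y \<noteq> {}"
proof -
  have "4 / real y > 0" if "y \<in> Y" for y
    using that \<open>Y \<subseteq> smooth q\<close> smooth_pos[of y q] q_ge by auto
  then show ?thesis
    unfolding unit_sum_def using that by (intro sum_pos) auto
qed

lemma sols_neg: "sols q r k = {}" if "r < 0"
proof -
  have False if "Y \<in> sols q r k" for Y
    using that \<open>r < 0\<close> unit_sum_pos[of Y]
    by (cases "Y = {}") (auto simp: sols_def unit_sum_def)
  then show ?thesis by blast
qed

lemma sols_zero: "sols q 0 k = (if k = 0 then {{}} else {})"
proof -
  have "Y = {}" if "Y \<in> sols q 0 k" for Y
    using that unit_sum_pos[of Y] by (auto simp: sols_def)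
  moreover have "{} \<in> sols q 0 k \<longleftrightarrow> k = 0"
    by (auto simp: sols_def unit_sum_def)
  ultimately show ?thesis by auto
qed

section \<open>The counting recursion\<close>

text \<open>Solving \<open>weight C + unit_sum Z / q = r\<close> for \<open>unit_sum Z\<close> gives
  the new remainder. The guard \<open>card C \<le> k\<close> matters: otherwise
  \<open>k - card C\<close> would be truncated to 0 and could admit sets with more than
  \<open>k\<close> elements.\<close>

lemma sols_unfold:
  "sols q r k = (\<lambda>(C, Z). join q C Z) `
     (SIGMA C : {C \<in> Pow {1, 2, 4}. card C \<le> k}.
        sols q (int q * (r - weight C)) (k - card C))"
  (is "_ = _ ` ?S")
proof (intro equalityI subsetI)
  have eq: "unit_sum (join q C Z) = of_int r \<longleftrightarrow>
      unit_sum Z = of_int (int q * (r - weight C))"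
    if "C \<subseteq> {1, 2, 4}" "finite Z" "Z \<subseteq> smooth q" for C Z
    using unit_sum_join[OF that] q_ge by (auto simp: field_simps)
  {
    fix Y assume Y: "Y \<in> sols q r k"
    obtain C Z where CZ: "C \<subseteq> {1, 2, 4}" "finite Z" "Z \<subseteq> smooth q" "Y = join q C Z"
      using join_surj[of Y] Y by (auto simp: sols_def)
    have "(C, Z) \<in> ?S"
      using Y CZ eq[OF CZ(1-3)] card_join[OF CZ(1-3)] by (auto simp: sols_def)
    then show "Y \<in> (\<lambda>(C, Z). join q C Z) ` ?S" using CZ(4) by force
  next
    fix Y assume "Y \<in> (\<lambda>(C, Z). join q C Z) ` ?S"
    then obtain C Z where CZ: "C \<subseteq> {1, 2, 4}" "card C \<le> k" "Y = join q C Z"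
      and Z: "Z \<in> sols q (int q * (r - weight C)) (k - card C)" by auto
    have Z': "finite Z" "Z \<subseteq> smooth q" using Z by (auto simp: sols_def)
    show "Y \<in> sols q r k"
      using join_facts(1-3)[OF CZ(1) Z'] eq[OF CZ(1) Z'] CZ(2,3) Z
      by (auto simp: sols_def)
  }
qed

text \<open>A nonempty \<open>C\<close> lowers \<open>k\<close>; the empty one keeps
  \<open>k\<close> but multiplies \<open>r > 0\<close> by \<open>q\<close>, so \<open>r\<close>
  grows until \<open>sols_large\<close> applies. Hence the nested inductions. Finiteness is needed
  to turn \<open>sols_unfold\<close> into an equation between cardinalities.\<close>

lemma finite_sols: "finite (sols q r k)"
proof (induction k arbitrary: r rule: less_induct)
  case (less k)
  show ?case
  proof (induction "nat (11 - r)" arbitrary: r rule: less_induct)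
    case inner: less
    \<comment> \<open>11 exceeds \<open>7 * q / (q - 1)\<close> for all \<open>q \<ge> 3\<close>\<close>
    consider "r < 0" | "r = 0" | "r \<ge> 11" | "0 < r" "r < 11" by linarith
    then show ?case
    proof cases
      case 3
      have "(int q - 1) * 11 \<le> (int q - 1) * r"
        using 3 q_ge by (intro mult_left_mono) auto
      then show ?thesis using sols_large[of r k] q_ge by simp
    next
      case 4
      have "finite (sols q (int q * (r - weight C)) (k - card C))"
        if "C \<in> {C \<in> Pow {1, 2, 4}. card C \<le> k}" for C
      proof (cases "C = {}")
        case True
        have "r < int q * r" using q_ge 4 by simp
        then show ?thesis using inner True 4 by (simp add: weight_def)
      next
        case False
        then have "card C > 0" using that by (auto simp: card_gt_0_iff intro: finite_subset)
        then show ?thesis using that by (intro less) auto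
      qed
      then show ?thesis
        by (subst sols_unfold) (intro finite_imageI finite_SigmaI; simp)
    qed (auto simp: sols_neg sols_zero)
  qed
qed

lemma card_sols:
  "card (sols q r k) = (\<Sum>C\<in>Pow {1, 2, 4}.
     if card C \<le> k then card (sols q (int q * (r - weight C)) (k - card C)) else 0)"
proof -
  have "inj_on (\<lambda>(C, Z). join q C Z)
     (SIGMA C : {C \<in> Pow {1, 2, 4}. card C \<le> k}.
        sols q (int q * (r - weight C)) (k - card C))"
    using join_inject by (auto simp: inj_on_def)
  then have "card (sols q r k) = (\<Sum>C\<in>{C \<in> Pow {1, 2, 4}. card C \<le> k}.
       card (sols q (int q * (r - weight C)) (k - card C)))"
    by (subst sols_unfold) (simp add: card_image card_SigmaI finite_sols)
  then show ?thesis by (subst sum.inter_filter[symmetric]) auto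
qed

text \<open>The arguments of \<open>N\<close> are a digit and its number of binary ones.\<close>
lemma card_sols_expand:
  "card (sols q r k) =
     (let N = (\<lambda>w c. if c \<le> k then card (sols q (int q * (r - w)) (k - c)) else 0)
      in N 0 0 + N 1 1 + N 2 1 + N 3 2 + N 4 1 + N 5 2 + N 6 2 + N 7 3)"
  unfolding card_sols[of r k]
  by (simp add: sum_Pow_insert weight_def Let_def)
    (simp only: numeral_2_eq_2 numeral_3_eq_3 simp_thms)

end

section \<open>Evaluating the recursion\<close>

interpretation three: odd_base 3 by unfold_locales auto
interpretation five: odd_base 5 by unfold_locales auto
interpretation seven: odd_base 7 by unfold_locales auto

lemma card_sols_3: "card (sols 3 4 9) = 52"
proof -
  \<comment> \<open>The positive multiples of 3 below the bound 21/2 are 3, 6 and 9; all other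
    nonzero remainders are dead.\<close>
  have r: "card (sols 3 3 k) = card (sols 3 9 k)
      + (if 1 \<le> k then card (sols 3 6 (k - 1)) + card (sols 3 3 (k - 1)) else 0)
      + (if k = 2 then 1 else 0)"
    "card (sols 3 6 k) = (if 2 \<le> k then card (sols 3 9 (k - 2)) + card (sols 3 3 (k - 2)) else 0)
      + (if 1 \<le> k then card (sols 3 6 (k - 1)) else 0)
      + (if k = 2 then 1 else 0)"
    "card (sols 3 9 k) = (if 2 \<le> k then card (sols 3 9 (k - 2)) else 0)
      + (if 3 \<le> k then card (sols 3 6 (k - 3)) else 0)"
    for k
    by (subst three.card_sols_expand, simp add: three.sols_large three.sols_neg three.sols_zero)+
  \<comment> \<open>As rewrite rules at concrete counts, these instances let simplification run the
    recursion; the count 1 appears there as \<open>Suc 0\<close>.\<close>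
  note r[of 0, simp] r[of "numeral n" for n, simp] r[of "Suc 0", simp]
  show ?thesis
    by (subst three.card_sols_expand, simp add: three.sols_large three.sols_neg three.sols_zero)
qed

lemma card_sols_5: "card (sols 5 4 9) = 1"
proof -
  \<comment> \<open>Only 5 survives as positive remainder: digit 4 returns to it, digit 5 ends the
    expansion.\<close>
  have r: "card (sols 5 5 k) = (if 1 \<le> k then card (sols 5 5 (k - 1)) else 0)
      + (if k = 2 then 1 else 0)" for k
    by (subst five.card_sols_expand, simp add: five.sols_large five.sols_neg five.sols_zero)
  note r[of 0, simp] r[of "numeral n" for n, simp] r[of "Suc 0", simp]
  show ?thesis
    by (subst five.card_sols_expand, simp add: five.sols_large five.sols_neg five.sols_zero)
qed

lemma card_sols_7: "card (sols 7 4 9) = 1"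
proof -
  \<comment> \<open>Only 7 survives as positive remainder: digit 6 returns to it, digit 7 ends the
    expansion.\<close>
  have r: "card (sols 7 7 k) = (if 2 \<le> k then card (sols 7 7 (k - 2)) else 0)
      + (if k = 3 then 1 else 0)" for k
    by (subst seven.card_sols_expand, simp add: seven.sols_large seven.sols_neg seven.sols_zero)
  note r[of 0, simp] r[of "numeral n" for n, simp] r[of "Suc 0", simp]
  show ?thesis
    by (subst seven.card_sols_expand, simp add: seven.sols_large seven.sols_neg seven.sols_zero)
qed

text \<open>After one step a positive remainder is a multiple of \<open>q\<close>, which already
  exceeds the bound. Only digit 4 leaves remainder 0, but then eight entries are still to be
  placed.\<close>

lemma (in odd_base) sols_empty: "sols q 4 9 = {}" if "q \<ge> 9"
proof -
  have "sols q (int q * s) k = {}" if "s \<ge> 1" for s k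
  proof (rule sols_large)
    have "7 * int q \<le> (int q - 1) * int q" using \<open>q \<ge> 9\<close> by (intro mult_right_mono) auto
    also have "\<dots> \<le> (int q - 1) * (int q * s)"
      using that \<open>q \<ge> 9\<close> by (intro mult_left_mono) auto
    finally show "7 * int q \<le> (int q - 1) * (int q * s)" .
  qed
  from this[of 1] this[of 2] this[of 3] this[of 4] have "card (sols q 4 9) = 0"
    using q_ge by (subst card_sols_expand) (simp add: sols_zero sols_neg)
  then show ?thesis using finite_sols by simp
qed

section \<open>Combining the primes\<close>

lemma smooth_Int_subset:
  assumes "prime p" "prime q" "p \<noteq> q" "odd p"
  shows "smooth p \<inter> smooth q \<subseteq> {1, 2, 4}"
proof
  fix x assume x: "x \<in> smooth p \<inter> smooth q"
  then obtain a b where q: "x = 2 ^ a * q ^ b" by (auto simp: smooth_def)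
  have "\<not> p dvd 2 ^ a"
    using assms prime_dvd_power[of p 2 a] primes_dvd_imp_eq[of p 2] by auto
  moreover have "\<not> p dvd q ^ b"
    using assms prime_dvd_power[of p q b] primes_dvd_imp_eq[of p q] by auto
  ultimately have "\<not> p dvd x"
    using assms(1) by (simp add: q prime_dvd_mult_iff)
  then show "x \<in> {1, 2, 4}" using x smooth_unfold[of p] by auto
qed

text \<open>Sets for different primes share at most the three entries 1, 2, 4, too few for nine, so
  no solution is counted twice.\<close>

lemma sols_disjoint:
  assumes "prime p" "prime q" "p \<noteq> q" "odd p"
  shows "sols p r 9 \<inter> sols q r 9 = {}"
proof -
  have False if X: "X \<in> sols p r 9" "X \<in> sols q r 9" for X
  proof -
    have "X \<subseteq> {1, 2, 4}" using X smooth_Int_subset[OF assms] by (auto simp: sols_def)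
    then have "card X \<le> card {1, 2, 4 :: nat}" by (intro card_mono) auto
    then show False using X by (simp add: sols_def)
  qed
  then show ?thesis by blast
qed

text \<open>The target 4 is the sum 1 after scaling by 4; positivity of the entries follows from
  \<open>q > 0\<close>.\<close>

lemma admissible_iff_sols: "admissible X \<longleftrightarrow> (\<exists>q. prime q \<and> odd q \<and> X \<in> sols q 4 9)"
proof -
  have "(\<Sum>x\<in>X. 1 / real x) = 1 \<longleftrightarrow> unit_sum X = 4"
    using sum_distrib_left[of 4 "\<lambda>x. 1 / real x" X] by (auto simp: unit_sum_def)
  moreover have "(\<forall>x\<in>X. \<exists>a b :: nat. a \<in> {0, 1, 2} \<and> x = 2 ^ a * q ^ b) \<longleftrightarrow> X \<subseteq> smooth q" for q
  proof -
    have "a \<in> {0, 1, 2} \<longleftrightarrow> a \<le> 2" for a :: nat by auto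
    then show ?thesis unfolding smooth_def by blast
  qed
  moreover have "card X = 9 \<Longrightarrow> finite X" by (auto intro: card_ge_0_finite)
  ultimately show ?thesis
    unfolding admissible_def sols_def by (auto dest: prime_gt_0_nat intro: smooth_pos)
qed

lemma admissible_eq: "{X. admissible X} = sols 3 4 9 \<union> sols 5 4 9 \<union> sols 7 4 9"
proof -
  have "q \<in> {3, 5, 7}" if "prime q" "odd q" "X \<in> sols q 4 9" for q X
  proof (rule ccontr)
    assume "q \<notin> {3, 5, 7}"
    moreover have "q \<ge> 3" using that prime_ge_2_nat[of q] by (cases "q = 2") auto
    moreover have "q \<notin> {4, 6, 8}" using \<open>odd q\<close> by auto
    ultimately have "q \<ge> 9" by auto
    interpret odd_base q using that \<open>q \<ge> 9\<close> by unfold_locales auto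
    show False using sols_empty \<open>q \<ge> 9\<close> that by blast
  qed
  moreover have "prime (3 :: nat)" "prime (5 :: nat)" "prime (7 :: nat)" by simp_all
  moreover have "odd (3 :: nat)" "odd (5 :: nat)" "odd (7 :: nat)" by simp_all
  ultimately show ?thesis unfolding admissible_iff_sols by blast
qed

theorem theorem1:
  shows "card {X :: nat set. admissible X} = 54"
proof -
  have "sols 3 4 9 \<inter> sols 5 4 9 = {}" "sols 3 4 9 \<inter> sols 7 4 9 = {}" "sols 5 4 9 \<inter> sols 7 4 9 = {}"
    by (intro sols_disjoint; simp)+
  then show ?thesis
    unfolding admissible_eq
    by (simp add: card_Un_disjoint Int_Un_distrib2 three.finite_sols five.finite_sols
        seven.finite_sols card_sols_3 card_sols_5 card_sols_7)
qed

end
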